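(* Let $f\colon\mathbf U_{/\mathfrak o}\to\mathbf U$ be the forgetful functor from the category of directed graphs (the oriented graphical category) to the category of undirected graphs (the graphical category). At the level of presheaves of sets, both left Kan extension $f_!\colon\widehat{\mathbf U_{/\mathfrak o}}\to\widehat{\mathbf U}$ and restriction $f^*\colon\widehat{\mathbf U}\to\widehat{\mathbf U_{/\mathfrak o}}$ preserve Segal objects.
   Context: $\widehat{\mathbf C}=\mathrm{Fun}(\mathbf C^{\mathrm{op}},\mathbf{Set})$; $f_!$ is the left adjoint of $f^*$. **Graphs.** A graph $G$ consists of finite sets $A_G$ (arcs) and $V_G$ (vertices), a fixpoint-free involution $a\mapsto a^\dagger$ on $A_G$, a subset $D_G\subseteq A_G$, and a function $t\colon D_G\to V_G$. For $v\in V_G$, $\mathrm{nb}(v)=t^{-1}(v)$; the boundary is $\partial(G)=A_G\setminus D_G$. A graph is connected if it is non-empty and is not a disjoint union of two non-empty graphs. The edge $\updownarrow$ is the graph with two arcs interchanged by $\dagger$ and $D=V=\varnothing$; the $n$-star $\star_n$ ($n\ge0$) has one vertex, $D=\{1,\dots,n\}$ and $A=\{1,1^\dagger,\dots,n,n^\dagger\}$. An étale map $f\colon H\to G$ consists of functions on $A$, $D$, $V$ compatible with the involutions, inclusions and $t$, restricting to a bijection $\mathrm{nb}(v)\to\mathrm{nb}(f(v))$ for each $v\in V_H$. An embedding is an étale map between connected graphs that is injective on vertices. $\mathrm{Emb}(G)$ is the set of classes $[f]$ of embeddings with codomain $G$, where $f\sim h$ iff $f=hz$ for an isomorphism $z$.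 A class $[f\colon H\to G]$ is an edge if $H\cong\updownarrow$. For $v\in V_G$, $\iota_v\colon\star_v\to G$ is the embedding whose domain has vertex set $\{v\}$, $D_{\star_v}=\mathrm{nb}(v)$, arc set $\mathrm{nb}(v)\amalg\{b_d:d\in\mathrm{nb}(v)\}$ with $d^\dagger=b_d$, and $\iota_v(d)=d$, $\iota_v(b_d)=d^\dagger$. For $f\colon H\to G$ put $\varsigma[f]=f(V_H)\subseteq V_G$, $\partial([f])=f(\partial(H))\subseteq A_G$. **The category $\mathbf U$.** Objects are connected graphs. A morphism (graphical map) $\varphi\colon G\to G'$ is a pair of an involutive function $\varphi_0\colon A_G\to A_{G'}$ and a function $\varphi_1\colon V_G\to\mathrm{Emb}(G')$ such that: (a) the sets $\varsigma(\varphi_1(v))$, $v\in V_G$, are pairwise disjoint; (b) for each $v$, $a\mapsto\varphi_0(a^\dagger)$ gives a bijection $\mathrm{nb}(v)\to\partial(\varphi_1(v))$; (c) if $\partial(G)=\varnothing$, there is $v$ with $\varphi_1(v)$ not an edge. The composite of $\varphi\colon G\to G'$ and $\psi\colon G'\to G''$ has $(\psi\varphi)_0=\psi_0\varphi_0$, and $(\psi\varphi)_1(v)$ is the unique class in $\mathrm{Emb}(G'')$ with boundary $\psi_0(\partial(\varphi_1(v)))$ and vertex set $\coprod_{w\in\varsigma(\varphi_1(v))}\varsigma(\psi_1(w))$. An embedding $f\colon H\to G$ is regarded as the graphical map given by $f$ on arcs and $v\mapsto[\iota_{f(v)}]$; such graphical maps are called inert. **The category $\mathbf U_{/\mathfrak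 o}$.** Objects are pairs $(G,x)$ with $G\in\mathbf U$ and $x\in\mathfrak o_G$, where $\mathfrak o_G$ is the set of functions $x\colon A_G\to\{+1,-1\}$ with $x(a^\dagger)=-x(a)$. Morphisms $(G,x)\to(G',x')$ are graphical maps $\varphi\colon G\to G'$ with $x'\circ\varphi_0=x$. A morphism is inert if its underlying graphical map is inert. The functor $f$ forgets $x$. **Segal objects.** Let $\mathbf C$ be $\mathbf U$ or $\mathbf U_{/\mathfrak o}$. An object is elementary if its underlying graph is isomorphic to an edge or to a star $\star_n$, $n\ge0$. For $c\in\mathbf C$, $\mathbf C^{\mathrm{el}}_{/c}$ is the category whose objects are inert maps $w\to c$ with $w$ elementary and whose morphisms are (inert) maps over $c$. A presheaf $Z\in\widehat{\mathbf C}$ is Segal if for every $c\in\mathbf C$ the canonical map $Z_c\to\lim_{(w\to c)\in(\mathbf C^{\mathrm{el}}_{/c})^{\mathrm{op}}}Z_w$ is a bijection. *)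

theory Defs
  imports Main "HOL-Library.FuncSet" "HOL-Library.Disjoint_Sets" "HOL-Library.Nat_Bijection"
begin

section \<open>Graphs\<close>

text \<open>
  The finite sets of arcs and vertices are finite subsets of \<^typ>\<open>nat\<close>; every finite graph is
  isomorphic to one of this form. All structure maps are extensional (\<^const>\<open>undefined\<close>
  outside their domain), so that equality of graphs and of maps is the intended one.
\<close>

record graph =
  arcs :: "nat set"
  verts :: "nat set"
  dag :: "nat \<Rightarrow> nat"
  inn :: "nat set"
  targ :: "nat \<Rightarrow> nat"

definition is_graph :: "graph \<Rightarrow> bool" where
  "is_graph G \<longleftrightarrow>
     finite (arcs G) \<and> finite (verts G) \<and>
     dag G \<in> arcs G \<rightarrow>\<^sub>E arcs G \<and>
     (\<forall>a\<in>arcs G. dag G (dag G a) = a \<and> dag G a \<noteq> a) \<and>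
     inn G \<subseteq> arcs G \<and>
     targ G \<in> inn G \<rightarrow>\<^sub>E verts G"

definition nb :: "graph \<Rightarrow> nat \<Rightarrow> nat set" where
  "nb G v = {d \<in> inn G. targ G d = v}"

definition bdry :: "graph \<Rightarrow> nat set" where
  "bdry G = arcs G - inn G"

definition nonempty_graph :: "graph \<Rightarrow> bool" where
  "nonempty_graph G \<longleftrightarrow> arcs G \<noteq> {} \<or> verts G \<noteq> {}"

definition is_disjoint_union :: "graph \<Rightarrow> graph \<Rightarrow> graph \<Rightarrow> bool" where
  "is_disjoint_union G H K \<longleftrightarrow>
     arcs G = arcs H \<union> arcs K \<and> arcs H \<inter> arcs K = {} \<and>
     verts G = verts H \<union> verts K \<and> verts H \<inter> verts K = {} \<and>
     inn G = inn H \<union> inn K \<and>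
     (\<forall>a\<in>arcs H. dag G a = dag H a) \<and> (\<forall>a\<in>arcs K. dag G a = dag K a) \<and>
     (\<forall>d\<in>inn H. targ G d = targ H d) \<and> (\<forall>d\<in>inn K. targ G d = targ K d)"

definition connected_graph :: "graph \<Rightarrow> bool" where
  "connected_graph G \<longleftrightarrow> is_graph G \<and> nonempty_graph G \<and>
     \<not> (\<exists>H K. is_graph H \<and> is_graph K \<and> nonempty_graph H \<and> nonempty_graph K \<and>
              is_disjoint_union G H K)"

definition edge_graph :: graph where
  "edge_graph = \<lparr>arcs = {0, 1}, verts = {}, dag = (\<lambda>a\<in>{0, 1}. 1 - a),
                 inn = {}, targ = (\<lambda>d\<in>{}. undefined)\<rparr>"

text \<open>
  The star with vertex \<open>v\<close> and neighbourhood (a copy of) \<open>S\<close>: the arc \<open>Inl d\<close> is \<open>d\<close> itself and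
  \<open>Inr d\<close> is the formal partner \<open>d\<^sup>\<dagger>\<close>; \<^const>\<open>sum_encode\<close> is the bijection from
  \<open>nat + nat\<close> to \<open>nat\<close>.
\<close>

definition star_on :: "nat set \<Rightarrow> nat \<Rightarrow> graph" where
  "star_on S v = \<lparr>arcs = sum_encode ` (S <+> S), verts = {v},
     dag = (\<lambda>a\<in>sum_encode ` (S <+> S).
              case sum_decode a of Inl d \<Rightarrow> sum_encode (Inr d) | Inr d \<Rightarrow> sum_encode (Inl d)),
     inn = sum_encode ` Inl ` S,
     targ = (\<lambda>d\<in>sum_encode ` Inl ` S. v)\<rparr>"

definition star :: "nat \<Rightarrow> graph" where
  "star n = star_on {1..n} 0"


section \<open>Etale maps and embeddings\<close>

text \<open>The component on \<^const>\<open>inn\<close> is the restriction of the component on arcs.\<close>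

record emap =
  edom :: graph
  ecod :: graph
  earc :: "nat \<Rightarrow> nat"
  evert :: "nat \<Rightarrow> nat"

definition etale :: "emap \<Rightarrow> bool" where
  "etale f \<longleftrightarrow> is_graph (edom f) \<and> is_graph (ecod f) \<and>
     earc f \<in> arcs (edom f) \<rightarrow>\<^sub>E arcs (ecod f) \<and>
     evert f \<in> verts (edom f) \<rightarrow>\<^sub>E verts (ecod f) \<and>
     (\<forall>a\<in>arcs (edom f). earc f (dag (edom f) a) = dag (ecod f) (earc f a)) \<and>
     earc f ` inn (edom f) \<subseteq> inn (ecod f) \<and>
     (\<forall>d\<in>inn (edom f). targ (ecod f) (earc f d) = evert f (targ (edom f) d)) \<and>
     (\<forall>v\<in>verts (edom f). bij_betw (earc f) (nb (edom f) v) (nb (ecod f) (evert f v)))"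

definition emap_id :: "graph \<Rightarrow> emap" where
  "emap_id G = \<lparr>edom = G, ecod = G, earc = (\<lambda>a\<in>arcs G. a), evert = (\<lambda>v\<in>verts G. v)\<rparr>"

definition emap_comp :: "emap \<Rightarrow> emap \<Rightarrow> emap" where
  "emap_comp h z = \<lparr>edom = edom z, ecod = ecod h,
     earc = compose (arcs (edom z)) (earc h) (earc z),
     evert = compose (verts (edom z)) (evert h) (evert z)\<rparr>"

definition graph_iso :: "emap \<Rightarrow> bool" where
  "graph_iso z \<longleftrightarrow> etale z \<and>
     bij_betw (earc z) (arcs (edom z)) (arcs (ecod z)) \<and>
     bij_betw (earc z) (inn (edom z)) (inn (ecod z)) \<and>
     bij_betw (evert z) (verts (edom z)) (verts (ecod z))"

definition isomorphic_graphs :: "graph \<Rightarrow> graph \<Rightarrow> bool" where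
  "isomorphic_graphs H G \<longleftrightarrow> (\<exists>z. graph_iso z \<and> edom z = H \<and> ecod z = G)"

definition embedding :: "emap \<Rightarrow> bool" where
  "embedding f \<longleftrightarrow> etale f \<and> connected_graph (edom f) \<and> connected_graph (ecod f) \<and>
     inj_on (evert f) (verts (edom f))"

definition embeddings_into :: "graph \<Rightarrow> emap set" where
  "embeddings_into G = {f. embedding f \<and> ecod f = G}"

definition emb_rel :: "graph \<Rightarrow> (emap \<times> emap) set" where
  "emb_rel G = {(f, h). f \<in> embeddings_into G \<and> h \<in> embeddings_into G \<and>
     (\<exists>z. graph_iso z \<and> edom z = edom f \<and> ecod z = edom h \<and> f = emap_comp h z)}"

definition Emb :: "graph \<Rightarrow> emap set set" where
  "Emb G = embeddings_into G // emb_rel G"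

definition emb_class :: "emap \<Rightarrow> emap set" where
  "emb_class f = emb_rel (ecod f) `` {f}"

text \<open>
  The next two functions lift \<open>f \<mapsto> f(V\<^sub>H)\<close> and \<open>f \<mapsto> f(\<partial>H)\<close> to classes. These sets do
  not depend on the representative, so each union is of copies of a single set.
\<close>

definition class_verts :: "emap set \<Rightarrow> nat set" where
  "class_verts c = (\<Union>f\<in>c. evert f ` verts (edom f))"

definition class_bdry :: "emap set \<Rightarrow> nat set" where
  "class_bdry c = (\<Union>f\<in>c. earc f ` bdry (edom f))"

definition edge_class :: "emap set \<Rightarrow> bool" where
  "edge_class c \<longleftrightarrow> (\<exists>f\<in>c. isomorphic_graphs (edom f) edge_graph)"

definition iota :: "graph \<Rightarrow> nat \<Rightarrow> emap" where
  "iota G v = \<lparr>edom = star_on (nb G v) v, ecod = G,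
     earc = (\<lambda>a\<in>arcs (star_on (nb G v) v).
               case sum_decode a of Inl d \<Rightarrow> d | Inr d \<Rightarrow> dag G d),
     evert = (\<lambda>w\<in>{v}. v)\<rparr>"


section \<open>Graphical maps\<close>

record gmap =
  gdom :: graph
  gcod :: graph
  gmap0 :: "nat \<Rightarrow> nat"
  gmap1 :: "nat \<Rightarrow> emap set"

definition graphical_map :: "gmap \<Rightarrow> bool" where
  "graphical_map \<phi> \<longleftrightarrow>
     connected_graph (gdom \<phi>) \<and> connected_graph (gcod \<phi>) \<and>
     gmap0 \<phi> \<in> arcs (gdom \<phi>) \<rightarrow>\<^sub>E arcs (gcod \<phi>) \<and>
     (\<forall>a\<in>arcs (gdom \<phi>). gmap0 \<phi> (dag (gdom \<phi>) a) = dag (gcod \<phi>) (gmap0 \<phi> a)) \<and>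
     gmap1 \<phi> \<in> verts (gdom \<phi>) \<rightarrow>\<^sub>E Emb (gcod \<phi>) \<and>
     disjoint_family_on (\<lambda>v. class_verts (gmap1 \<phi> v)) (verts (gdom \<phi>)) \<and>
     (\<forall>v\<in>verts (gdom \<phi>).
        bij_betw (\<lambda>a. gmap0 \<phi> (dag (gdom \<phi>) a)) (nb (gdom \<phi>) v) (class_bdry (gmap1 \<phi> v))) \<and>
     (bdry (gdom \<phi>) = {} \<longrightarrow> (\<exists>v\<in>verts (gdom \<phi>). \<not> edge_class (gmap1 \<phi> v)))"

definition gcomp :: "gmap \<Rightarrow> gmap \<Rightarrow> gmap" where
  "gcomp \<psi> \<phi> = \<lparr>gdom = gdom \<phi>, gcod = gcod \<psi>,
     gmap0 = compose (arcs (gdom \<phi>)) (gmap0 \<psi>) (gmap0 \<phi>),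
     gmap1 = (\<lambda>v\<in>verts (gdom \<phi>).
       THE c. c \<in> Emb (gcod \<psi>) \<and>
              class_bdry c = gmap0 \<psi> ` class_bdry (gmap1 \<phi> v) \<and>
              class_verts c = (\<Union>w\<in>class_verts (gmap1 \<phi> v). class_verts (gmap1 \<psi> w)))\<rparr>"

definition gmap_of :: "emap \<Rightarrow> gmap" where
  "gmap_of f = \<lparr>gdom = edom f, gcod = ecod f, gmap0 = earc f,
     gmap1 = (\<lambda>v\<in>verts (edom f). emb_class (iota (ecod f) (evert f v)))\<rparr>"

definition inert :: "gmap \<Rightarrow> bool" where
  "inert \<phi> \<longleftrightarrow> (\<exists>f. embedding f \<and> \<phi> = gmap_of f)"

definition gid :: "graph \<Rightarrow> gmap" where
  "gid G = gmap_of (emap_id G)"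

definition elementary_graph :: "graph \<Rightarrow> bool" where
  "elementary_graph G \<longleftrightarrow> isomorphic_graphs G edge_graph \<or> (\<exists>n. isomorphic_graphs G (star n))"


section \<open>Categories, presheaves and Segal objects\<close>

text \<open>A category together with distinguished classes of inert maps and elementary objects.\<close>

record ('o, 'm) cat =
  Obj :: "'o set"
  Arr :: "'m set"
  Dom :: "'m \<Rightarrow> 'o"
  Cod :: "'m \<Rightarrow> 'o"
  Id :: "'o \<Rightarrow> 'm"
  Comp :: "'m \<Rightarrow> 'm \<Rightarrow> 'm"
  Inert :: "'m set"
  Elem :: "'o set"

record ('o, 'm, 'x) presheaf =
  Val :: "'o \<Rightarrow> 'x set"
  Res :: "'m \<Rightarrow> 'x \<Rightarrow> 'x"

definition is_presheaf :: "('o, 'm) cat \<Rightarrow> ('o, 'm, 'x) presheaf \<Rightarrow> bool" where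
  "is_presheaf C Z \<longleftrightarrow>
     (\<forall>f\<in>Arr C. Res Z f \<in> Val Z (Cod C f) \<rightarrow> Val Z (Dom C f)) \<and>
     (\<forall>c\<in>Obj C. \<forall>z\<in>Val Z c. Res Z (Id C c) z = z) \<and>
     (\<forall>f\<in>Arr C. \<forall>g\<in>Arr C. Cod C f = Dom C g \<longrightarrow>
        (\<forall>z\<in>Val Z (Cod C g). Res Z (Comp C g f) z = Res Z f (Res Z g z)))"

definition nat_trans ::
  "('o, 'm) cat \<Rightarrow> ('o, 'm, 'x) presheaf \<Rightarrow> ('o, 'm, 'x) presheaf \<Rightarrow> ('o \<Rightarrow> 'x \<Rightarrow> 'x) \<Rightarrow> bool" where
  "nat_trans C Z Y \<beta> \<longleftrightarrow>
     \<beta> \<in> (\<Pi>\<^sub>E c\<in>Obj C. Val Z c \<rightarrow>\<^sub>E Val Y c) \<and>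
     (\<forall>f\<in>Arr C. \<forall>z\<in>Val Z (Cod C f). \<beta> (Dom C f) (Res Z f z) = Res Y f (\<beta> (Cod C f) z))"

text \<open>The objects of the category of elementary objects over \<open>c\<close>.\<close>

definition elts_over :: "('o, 'm) cat \<Rightarrow> 'o \<Rightarrow> 'm set" where
  "elts_over C c = {p \<in> Arr C. p \<in> Inert C \<and> Dom C p \<in> Elem C \<and> Cod C p = c}"

text \<open>The limit over that category, as the set of compatible families.\<close>

definition segal_limit :: "('o, 'm) cat \<Rightarrow> ('o, 'm, 'x) presheaf \<Rightarrow> 'o \<Rightarrow> ('m \<Rightarrow> 'x) set" where
  "segal_limit C Z c =
     {s \<in> (\<Pi>\<^sub>E p\<in>elts_over C c. Val Z (Dom C p)).
        \<forall>p\<in>elts_over C c. \<forall>q\<in>elts_over C c. \<forall>h\<in>Arr C.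
          h \<in> Inert C \<and> Dom C h = Dom C p \<and> Cod C h = Dom C q \<and> Comp C q h = p \<longrightarrow>
          Res Z h (s q) = s p}"

definition segal :: "('o, 'm) cat \<Rightarrow> ('o, 'm, 'x) presheaf \<Rightarrow> bool" where
  "segal C Z \<longleftrightarrow> is_presheaf C Z \<and>
     (\<forall>c\<in>Obj C. bij_betw (\<lambda>z. \<lambda>p\<in>elts_over C c. Res Z p z) (Val Z c) (segal_limit C Z c))"

record ('o, 'm, 'o1, 'm1) funct =
  FObj :: "'o \<Rightarrow> 'o1"
  FArr :: "'m \<Rightarrow> 'm1"

definition restriction ::
  "('o, 'm, 'o1, 'm1) funct \<Rightarrow> ('o1, 'm1, 'x) presheaf \<Rightarrow> ('o, 'm, 'x) presheaf" where
  "restriction F Y = \<lparr>Val = (\<lambda>c. Val Y (FObj F c)), Res = (\<lambda>f. Res Y (FArr F f))\<rparr>"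

text \<open>
  \<open>W\<close> with unit \<open>\<eta>\<close> is the value at \<open>Z\<close> of the left adjoint of restriction along \<open>F\<close>, that is,
  \<open>\<eta>\<close> is a universal arrow from \<open>Z\<close> to the functor \<open>restriction F\<close>. Here sets are the subsets
  of the type \<open>'x\<close>.
\<close>

definition left_kan ::
  "('o, 'm) cat \<Rightarrow> ('o1, 'm1) cat \<Rightarrow> ('o, 'm, 'o1, 'm1) funct \<Rightarrow>
   ('o, 'm, 'x) presheaf \<Rightarrow> ('o1, 'm1, 'x) presheaf \<Rightarrow> ('o \<Rightarrow> 'x \<Rightarrow> 'x) \<Rightarrow> bool" where
  "left_kan C D F Z W \<eta> \<longleftrightarrow>
     is_presheaf D W \<and> nat_trans C Z (restriction F W) \<eta> \<and>
     (\<forall>Y \<alpha>. is_presheaf D Y \<and> nat_trans C Z (restriction F Y) \<alpha> \<longrightarrow>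
        (\<exists>!\<beta>. nat_trans D W Y \<beta> \<and>
              (\<forall>c\<in>Obj C. \<forall>z\<in>Val Z c. \<beta> (FObj F c) (\<eta> c z) = \<alpha> c z)))"


section \<open>The graphical category and its oriented version\<close>

definition U_cat :: "(graph, gmap) cat" where
  "U_cat = \<lparr>Obj = Collect connected_graph, Arr = Collect graphical_map,
     Dom = gdom, Cod = gcod, Id = gid, Comp = gcomp,
     Inert = Collect inert, Elem = {G. connected_graph G \<and> elementary_graph G}\<rparr>"

definition orientations :: "graph \<Rightarrow> (nat \<Rightarrow> int) set" where
  "orientations G = {x \<in> arcs G \<rightarrow>\<^sub>E {1, -1}. \<forall>a\<in>arcs G. x (dag G a) = - x a}"

type_synonym ograph = "graph \<times> (nat \<Rightarrow> int)"

text \<open>The triple \<open>(x, \<phi>, x')\<close> is the morphism from \<open>(gdom \<phi>, x)\<close> to \<open>(gcod \<phi>, x')\<close> given by \<open>\<phi>\<close>.\<close>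

type_synonym omap = "(nat \<Rightarrow> int) \<times> gmap \<times> (nat \<Rightarrow> int)"

definition Uo_cat :: "(ograph, omap) cat" where
  "Uo_cat = \<lparr>
     Obj = {(G, x). connected_graph G \<and> x \<in> orientations G},
     Arr = {(x, \<phi>, x'). graphical_map \<phi> \<and>
              x \<in> orientations (gdom \<phi>) \<and> x' \<in> orientations (gcod \<phi>) \<and>
              (\<forall>a\<in>arcs (gdom \<phi>). x' (gmap0 \<phi> a) = x a)},
     Dom = (\<lambda>(x, \<phi>, x'). (gdom \<phi>, x)),
     Cod = (\<lambda>(x, \<phi>, x'). (gcod \<phi>, x')),
     Id = (\<lambda>(G, x). (x, gid G, x)),
     Comp = (\<lambda>(y, \<psi>, y') (x, \<phi>, x'). (x, gcomp \<psi> \<phi>, y')),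
     Inert = {(x, \<phi>, x'). inert \<phi>},
     Elem = {(G, x). connected_graph G \<and> x \<in> orientations G \<and> elementary_graph G}\<rparr>"

definition forget :: "(ograph, omap, graph, gmap) funct" where
  "forget = \<lparr>FObj = fst, FArr = (\<lambda>(x, \<phi>, x'). \<phi>)\<rparr>"

end

theory Submission
  imports Defs
begin

text \<open>
  The forgetful functor is a discrete fibration: a graphical map into \<open>G\<close> lifts uniquely along
  each orientation of \<open>G\<close>. Hence \<open>(G, x)\<close> and \<open>G\<close> have the same elementary objects over them,
  which gives the claim for restriction, and the left Kan extension of \<open>Z\<close> is
  \<open>G \<mapsto> \<Coprod>\<^sub>x Z (G, x)\<close>. Orientations themselves satisfy the Segal condition, since an
  orientation is determined by its values on the edges \<open>\<updownarrow> \<rightarrow> G\<close>, one for each arc of \<open>G\<close>. So a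
  compatible family in the Kan extension yields first an orientation \<open>x\<close> of \<open>G\<close> and then an
  element of \<open>Z (G, x)\<close>.
\<close>

section \<open>Compatible families and the universal property\<close>

text \<open>The points of the limit without the extensionality that \<open>segal_limit\<close>
  imposes. A family can then be given by any function, its values off \<open>elts_over C c\<close>
  being irrelevant.\<close>

definition compatible ::
  "('o, 'm) cat \<Rightarrow> ('o, 'm, 'x) presheaf \<Rightarrow> 'o \<Rightarrow> ('m \<Rightarrow> 'x) \<Rightarrow> bool" where
  "compatible C Z c s \<longleftrightarrow>
     (\<forall>p\<in>elts_over C c. s p \<in> Val Z (Dom C p)) \<and>
     (\<forall>p\<in>elts_over C c. \<forall>q\<in>elts_over C c. \<forall>h\<in>Arr C.
        h \<in> Inert C \<and> Dom C h = Dom C p \<and> Cod C h = Dom C q \<and> Comp C q h = p \<longrightarrow>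
        Res Z h (s q) = s p)"

definition glues :: "('o, 'm) cat \<Rightarrow> ('o, 'm, 'x) presheaf \<Rightarrow> 'o \<Rightarrow> ('m \<Rightarrow> 'x) \<Rightarrow> 'x \<Rightarrow> bool" where
  "glues C Z c s z \<longleftrightarrow> z \<in> Val Z c \<and> (\<forall>p\<in>elts_over C c. Res Z p z = s p)"

lemma compatible_cong:
  assumes "\<And>p. p \<in> elts_over C c \<Longrightarrow> s p = t p"
  shows "compatible C Z c s \<longleftrightarrow> compatible C Z c t"
  unfolding compatible_def using assms by simp

lemma segal_limit_eq:
  "segal_limit C Z c = {s \<in> extensional (elts_over C c). compatible C Z c s}"
  unfolding segal_limit_def compatible_def by (auto simp: PiE_def)

lemma elts_overD:
  assumes "p \<in> elts_over C c"
  shows "p \<in> Arr C" "Cod C p = c"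
  using assms by (auto simp: elts_over_def)

lemma presheaf_Res_in:
  assumes "is_presheaf C Z" "f \<in> Arr C" "z \<in> Val Z (Cod C f)"
  shows "Res Z f z \<in> Val Z (Dom C f)"
  using assms by (auto simp: is_presheaf_def)

lemma presheaf_Res_Comp:
  assumes "is_presheaf C Z" "f \<in> Arr C" "g \<in> Arr C" "Cod C f = Dom C g" "z \<in> Val Z (Cod C g)"
  shows "Res Z (Comp C g f) z = Res Z f (Res Z g z)"
  using assms by (auto simp: is_presheaf_def)

lemma compatible_restrictions:
  assumes Z: "is_presheaf C Z" and z: "z \<in> Val Z c"
  shows "compatible C Z c (\<lambda>p. Res Z p z)"
  unfolding compatible_def
proof (intro conjI ballI impI)
  show "Res Z p z \<in> Val Z (Dom C p)" if "p \<in> elts_over C c" for p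
    using presheaf_Res_in[OF Z] elts_overD[OF that] z by metis
next
  fix p q h
  assume "p \<in> elts_over C c" "q \<in> elts_over C c" "h \<in> Arr C"
    and "h \<in> Inert C \<and> Dom C h = Dom C p \<and> Cod C h = Dom C q \<and> Comp C q h = p"
  then show "Res Z h (Res Z q z) = Res Z p z"
    using presheaf_Res_Comp[OF Z, of h q z] elts_overD[of q C c] z by metis
qed

lemma restrict_eq_iff: "restrict f A = restrict g A \<longleftrightarrow> (\<forall>a\<in>A. f a = g a)"
  by (metis restrict_apply' restrict_ext)

lemma bij_betw_iff_ex1:
  assumes "f \<in> A \<rightarrow> B"
  shows "bij_betw f A B \<longleftrightarrow> (\<forall>b\<in>B. \<exists>!a. a \<in> A \<and> f a = b)"
proof
  assume "bij_betw f A B"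
  then show "\<forall>b\<in>B. \<exists>!a. a \<in> A \<and> f a = b"
    unfolding bij_betw_def inj_on_def by blast
next
  assume ex1: "\<forall>b\<in>B. \<exists>!a. a \<in> A \<and> f a = b"
  have "inj_on f A"
    using ex1 assms by (intro inj_onI) (metis PiE)
  moreover have "f ` A = B"
    using ex1 assms by blast
  ultimately show "bij_betw f A B"
    by (simp add: bij_betw_def)
qed

text \<open>Bijectivity is unique existence of preimages, and both \<open>compatible\<close> and
  \<open>glues\<close> depend on \<open>s\<close> only through its values on
  \<open>elts_over C c\<close>, so passing to the extensional representative is harmless. All Segal
  conditions below are handled in this form.\<close>

lemma segal_iff_glues:
  "segal C Z \<longleftrightarrow>
     is_presheaf C Z \<and> (\<forall>c\<in>Obj C. \<forall>s. compatible C Z c s \<longrightarrow> (\<exists>!z. glues C Z c s z))"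
proof (cases "is_presheaf C Z")
  case True
  have "bij_betw (\<lambda>z. \<lambda>p\<in>elts_over C c. Res Z p z) (Val Z c) (segal_limit C Z c) \<longleftrightarrow>
        (\<forall>s. compatible C Z c s \<longrightarrow> (\<exists>!z. glues C Z c s z))" (is "bij_betw ?r _ _ \<longleftrightarrow> ?R") for c
  proof -
    let ?E = "elts_over C c"
    have r: "?r \<in> Val Z c \<rightarrow> segal_limit C Z c"
    proof
      fix z assume "z \<in> Val Z c"
      then have "compatible C Z c (\<lambda>p. Res Z p z)"
        by (rule compatible_restrictions[OF True])
      then have "compatible C Z c (?r z)"
        by (subst compatible_cong[where t = "\<lambda>p. Res Z p z"]) auto
      then show "?r z \<in> segal_limit C Z c"
        by (simp add: segal_limit_eq)
    qed
    have gl: "glues C Z c s z \<longleftrightarrow> z \<in> Val Z c \<and> ?r z = restrict s ?E" for s z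
      unfolding glues_def restrict_eq_iff ..
    have "bij_betw ?r (Val Z c) (segal_limit C Z c) \<longleftrightarrow>
          (\<forall>s\<in>segal_limit C Z c. \<exists>!z. z \<in> Val Z c \<and> ?r z = s)"
      by (rule bij_betw_iff_ex1[OF r])
    also have "\<dots> \<longleftrightarrow> ?R"
    proof
      assume L: "\<forall>s\<in>segal_limit C Z c. \<exists>!z. z \<in> Val Z c \<and> ?r z = s"
      show ?R
      proof (intro allI impI)
        fix s assume "compatible C Z c s"
        then have "restrict s ?E \<in> segal_limit C Z c"
          by (subst segal_limit_eq) (simp add: compatible_cong[where s = "restrict s ?E" and t = s])
        then show "\<exists>!z. glues C Z c s z"
          using L unfolding gl by blast
      qed
    next
      assume R: ?R
      show "\<forall>s\<in>segal_limit C Z c. \<exists>!z. z \<in> Val Z c \<and> ?r z = s"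
      proof
        fix s assume "s \<in> segal_limit C Z c"
        then have "compatible C Z c s" "restrict s ?E = s"
          by (auto simp: segal_limit_eq extensional_restrict)
        then show "\<exists>!z. z \<in> Val Z c \<and> ?r z = s"
          using R gl[of s] by (metis (no_types))
      qed
    qed
    finally show ?thesis .
  qed
  then show ?thesis
    by (simp add: segal_def)
qed (simp add: segal_def)

section \<open>Natural transformations and invariance under isomorphism\<close>

lemma nat_trans_in:
  assumes "nat_trans C Z Y \<beta>" "c \<in> Obj C" "z \<in> Val Z c"
  shows "\<beta> c z \<in> Val Y c"
  using assms unfolding nat_trans_def by (blast dest: PiE_mem)

lemma nat_trans_natural:
  assumes "nat_trans C Z Y \<beta>" "f \<in> Arr C" "z \<in> Val Z (Cod C f)"
  shows "\<beta> (Dom C f) (Res Z f z) = Res Y f (\<beta> (Cod C f) z)"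
  using assms by (simp add: nat_trans_def)

lemma nat_trans_eqI:
  assumes "nat_trans C Z Y \<beta>" "nat_trans C Z Y \<gamma>"
    and "\<And>c z. c \<in> Obj C \<Longrightarrow> z \<in> Val Z c \<Longrightarrow> \<beta> c z = \<gamma> c z"
  shows "\<beta> = \<gamma>"
proof (rule PiE_ext)
  show "\<beta> \<in> (\<Pi>\<^sub>E c\<in>Obj C. Val Z c \<rightarrow>\<^sub>E Val Y c)" "\<gamma> \<in> (\<Pi>\<^sub>E c\<in>Obj C. Val Z c \<rightarrow>\<^sub>E Val Y c)"
    using assms(1,2) by (simp_all add: nat_trans_def)
  then show "\<beta> c = \<gamma> c" if "c \<in> Obj C" for c
    using that assms(3) by (intro PiE_ext[of "\<beta> c" "Val Z c" "\<lambda>_. Val Y c"]) (auto dest: PiE_mem)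
qed

text \<open>Natural transformations are extensional in both arguments, so a family given by a
  formula has to be cut down first. Naturality survives because the objects and elements in the
  naturality square stay in the domains of definition.\<close>

lemma nat_trans_restrict:
  assumes Z: "is_presheaf C Z"
    and ends: "\<And>f. f \<in> Arr C \<Longrightarrow> Dom C f \<in> Obj C \<and> Cod C f \<in> Obj C"
    and "\<And>c z. c \<in> Obj C \<Longrightarrow> z \<in> Val Z c \<Longrightarrow> \<beta> c z \<in> Val Y c"
    and "\<And>f z. f \<in> Arr C \<Longrightarrow> z \<in> Val Z (Cod C f) \<Longrightarrow>
           \<beta> (Dom C f) (Res Z f z) = Res Y f (\<beta> (Cod C f) z)"
  shows "nat_trans C Z Y (\<lambda>c\<in>Obj C. \<lambda>z\<in>Val Z c. \<beta> c z)"
  unfolding nat_trans_def using assms presheaf_Res_in[OF Z] by auto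

text \<open>Uniqueness of universal arrows: each unit factors through the other, and both composites
  of the two factorisations must be identities.\<close>

lemma left_kan_unique_up_to_iso:
  assumes W: "left_kan C D F Z W \<eta>" and V: "left_kan C D F Z V \<theta>"
    and D: "\<And>f. f \<in> Arr D \<Longrightarrow> Dom D f \<in> Obj D \<and> Cod D f \<in> Obj D"
    and F: "\<And>c. c \<in> Obj C \<Longrightarrow> FObj F c \<in> Obj D"
  obtains \<beta> \<gamma> where "nat_trans D W V \<beta>" "nat_trans D V W \<gamma>"
    "\<And>d w. d \<in> Obj D \<Longrightarrow> w \<in> Val W d \<Longrightarrow> \<gamma> d (\<beta> d w) = w"
    "\<And>d v. d \<in> Obj D \<Longrightarrow> v \<in> Val V d \<Longrightarrow> \<beta> d (\<gamma> d v) = v"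
proof -
  have ex: "\<exists>\<beta>. nat_trans D W V \<beta> \<and> (\<forall>c\<in>Obj C. \<forall>z\<in>Val Z c. \<beta> (FObj F c) (\<eta> c z) = \<theta> c z)"
    if "left_kan C D F Z W \<eta>" "left_kan C D F Z V \<theta>" for W V \<eta> \<theta>
    using that unfolding left_kan_def by blast
  \<comment> \<open>Stated for arbitrary presheaves and units, so that it can be used a second time
    with the two roles exchanged.\<close>
  have inv: "\<gamma> d (\<beta> d w) = w"
    if W: "left_kan C D F Z W \<eta>"
      and b: "nat_trans D W V \<beta>" "\<forall>c\<in>Obj C. \<forall>z\<in>Val Z c. \<beta> (FObj F c) (\<eta> c z) = \<theta> c z"
      and g: "nat_trans D V W \<gamma>" "\<forall>c\<in>Obj C. \<forall>z\<in>Val Z c. \<gamma> (FObj F c) (\<theta> c z) = \<eta> c z"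
      and d: "d \<in> Obj D" "w \<in> Val W d" for W V \<eta> \<theta> \<beta> \<gamma> d w
  proof -
    let ?id = "\<lambda>d\<in>Obj D. \<lambda>w\<in>Val W d. w" and ?gb = "\<lambda>d\<in>Obj D. \<lambda>w\<in>Val W d. \<gamma> d (\<beta> d w)"
    have pW: "is_presheaf D W" and eta: "nat_trans C Z (restriction F W) \<eta>"
      using W by (auto simp: left_kan_def)
    have eta_in: "\<eta> c z \<in> Val W (FObj F c)" if "c \<in> Obj C" "z \<in> Val Z c" for c z
      using nat_trans_in[OF eta that] by (simp add: restriction_def)
    have "nat_trans D W W ?id"
      by (rule nat_trans_restrict[OF pW D]) auto
    moreover have "nat_trans D W W ?gb"
      using D nat_trans_in[OF b(1)] nat_trans_in[OF g(1)] nat_trans_natural[OF b(1)]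
        nat_trans_natural[OF g(1)]
      by (intro nat_trans_restrict[OF pW D]) auto
    moreover have "\<forall>c\<in>Obj C. \<forall>z\<in>Val Z c. ?id (FObj F c) (\<eta> c z) = \<eta> c z"
      "\<forall>c\<in>Obj C. \<forall>z\<in>Val Z c. ?gb (FObj F c) (\<eta> c z) = \<eta> c z"
      using F eta_in b(2) g(2) by auto
    \<comment> \<open>Both transformations factor \<open>\<eta>\<close> through itself, so the
      uniqueness clause for \<open>W\<close>, taken with target \<open>W\<close>, identifies
      them.\<close>
    ultimately have "?gb = ?id"
      using W unfolding left_kan_def by blast
    then have "?gb d w = ?id d w"
      by (rule arg_cong)
    then show ?thesis
      using d by simp
  qed
  obtain \<beta> where b: "nat_trans D W V \<beta>"
    "\<forall>c\<in>Obj C. \<forall>z\<in>Val Z c. \<beta> (FObj F c) (\<eta> c z) = \<theta> c z"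
    using ex[OF W V] by blast
  obtain \<gamma> where g: "nat_trans D V W \<gamma>"
    "\<forall>c\<in>Obj C. \<forall>z\<in>Val Z c. \<gamma> (FObj F c) (\<theta> c z) = \<eta> c z"
    using ex[OF V W] by blast
  show ?thesis
    by (rule that[OF b(1) g(1) inv[OF W b g] inv[OF V g b]])
qed

text \<open>A left Kan extension is determined only up to isomorphism, so the Segal condition has to
  pass from one explicit model to all others. A family in \<open>W\<close> is carried to
  \<open>V\<close> by \<open>\<beta>\<close>, glued there, and the result is carried back by
  \<open>\<gamma>\<close>.\<close>

lemma segal_iso_transfer:
  assumes V: "segal D V" and W: "is_presheaf D W"
    and D: "\<And>f. f \<in> Arr D \<Longrightarrow> Dom D f \<in> Obj D \<and> Cod D f \<in> Obj D"
    and b: "nat_trans D W V \<beta>" and g: "nat_trans D V W \<gamma>"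
    and gb: "\<And>d w. d \<in> Obj D \<Longrightarrow> w \<in> Val W d \<Longrightarrow> \<gamma> d (\<beta> d w) = w"
    and bg: "\<And>d v. d \<in> Obj D \<Longrightarrow> v \<in> Val V d \<Longrightarrow> \<beta> d (\<gamma> d v) = v"
  shows "segal D W"
  unfolding segal_iff_glues
proof (intro conjI ballI allI impI)
  show "is_presheaf D W" by (rule W)
next
  fix d s
  assume d: "d \<in> Obj D" and s: "compatible D W d s"
  let ?t = "\<lambda>p. \<beta> (Dom D p) (s p)"
  have s_in: "s p \<in> Val W (Dom D p)" if "p \<in> elts_over D d" for p
    using s that by (auto simp: compatible_def)
  have "compatible D V d ?t"
    unfolding compatible_def
  proof (intro conjI ballI impI)
    show "?t p \<in> Val V (Dom D p)" if "p \<in> elts_over D d" for p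
      using nat_trans_in[OF b] s_in[OF that] D elts_overD[OF that] by blast
  next
    fix p q h
    assume p: "p \<in> elts_over D d" and q: "q \<in> elts_over D d" and h: "h \<in> Arr D"
      and H: "h \<in> Inert D \<and> Dom D h = Dom D p \<and> Cod D h = Dom D q \<and> Comp D q h = p"
    have "Res W h (s q) = s p"
      using s p q h H unfolding compatible_def by blast
    then show "Res V h (?t q) = ?t p"
      using nat_trans_natural[OF b h, of "s q"] s_in[OF q] H by simp
  qed
  then obtain v where v: "glues D V d ?t v" and v_unique: "\<And>v'. glues D V d ?t v' \<Longrightarrow> v' = v"
    using V d unfolding segal_iff_glues by blast
  show "\<exists>!w. glues D W d s w"
  proof (rule ex1I)
    show "glues D W d s (\<gamma> d v)"
      unfolding glues_def
    proof (intro conjI ballI)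
      show "\<gamma> d v \<in> Val W d"
        using v nat_trans_in[OF g d] by (simp add: glues_def)
      fix p assume p: "p \<in> elts_over D d"
      note pD = elts_overD[OF p]
      have "Res W p (\<gamma> d v) = \<gamma> (Dom D p) (Res V p v)"
        using nat_trans_natural[OF g pD(1), of v] v pD by (simp add: glues_def)
      also have "\<dots> = s p"
        using v p s_in[OF p] gb D[OF pD(1)] by (simp add: glues_def)
      finally show "Res W p (\<gamma> d v) = s p" .
    qed
  next
    fix w assume w: "glues D W d s w"
    have "glues D V d ?t (\<beta> d w)"
      unfolding glues_def
    proof (intro conjI ballI)
      show "\<beta> d w \<in> Val V d"
        using w nat_trans_in[OF b d] by (simp add: glues_def)
      fix p assume p: "p \<in> elts_over D d"
      show "Res V p (\<beta> d w) = ?t p"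
        using nat_trans_natural[OF b elts_overD(1)[OF p], of w] w p elts_overD[OF p]
        by (simp add: glues_def)
    qed
    then show "w = \<gamma> d v"
      using v_unique gb[OF d] w by (metis glues_def)
  qed
qed

section \<open>Lifting graphical maps along orientations\<close>

lemma U_cat_simps [simp]:
  "Obj U_cat = Collect connected_graph" "Arr U_cat = Collect graphical_map"
  "Dom U_cat = gdom" "Cod U_cat = gcod" "Id U_cat = gid" "Comp U_cat = gcomp"
  "Inert U_cat = Collect inert" "Elem U_cat = {G. connected_graph G \<and> elementary_graph G}"
  by (simp_all add: U_cat_def)

lemma Uo_cat_simps [simp]:
  "(G, x) \<in> Obj Uo_cat \<longleftrightarrow> connected_graph G \<and> x \<in> orientations G"
  "Dom Uo_cat (x, \<phi>, x') = (gdom \<phi>, x)"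
  "Cod Uo_cat (x, \<phi>, x') = (gcod \<phi>, x')"
  "Id Uo_cat (G, x) = (x, gid G, x)"
  "Comp Uo_cat (y, \<psi>, y') (x, \<phi>, x') = (x, gcomp \<psi> \<phi>, y')"
  "(x, \<phi>, x') \<in> Inert Uo_cat \<longleftrightarrow> inert \<phi>"
  "(G, x) \<in> Elem Uo_cat \<longleftrightarrow> connected_graph G \<and> x \<in> orientations G \<and> elementary_graph G"
  by (simp_all add: Uo_cat_def)

lemma forget_simps [simp]: "FObj forget (G, x) = G" "FArr forget (x, \<phi>, x') = \<phi>"
  by (simp_all add: forget_def)

lemma gcomp_simps [simp]: "gdom (gcomp \<psi> \<phi>) = gdom \<phi>" "gcod (gcomp \<psi> \<phi>) = gcod \<psi>"
  by (simp_all add: gcomp_def)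

lemma gid_simps [simp]: "gdom (gid G) = G" "gcod (gid G) = G" "gmap0 (gid G) = (\<lambda>a\<in>arcs G. a)"
  by (simp_all add: gid_def gmap_of_def emap_id_def)

lemma graphical_map_ends:
  assumes "graphical_map \<phi>"
  shows "connected_graph (gdom \<phi>)" "connected_graph (gcod \<phi>)"
  using assms by (simp_all add: graphical_map_def)

lemma U_ends:
  assumes "f \<in> Arr U_cat"
  shows "Dom U_cat f \<in> Obj U_cat \<and> Cod U_cat f \<in> Obj U_cat"
  using assms by (auto simp: graphical_map_ends)

lemma FObj_forget_in: "c \<in> Obj Uo_cat \<Longrightarrow> FObj forget c \<in> Obj U_cat"
  by (cases c) simp

lemma gmap0_arc:
  assumes "graphical_map \<phi>" "a \<in> arcs (gdom \<phi>)"
  shows "gmap0 \<phi> a \<in> arcs (gcod \<phi>)"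
    and "gmap0 \<phi> (dag (gdom \<phi>) a) = dag (gcod \<phi>) (gmap0 \<phi> a)"
  using assms by (auto simp: graphical_map_def)

lemma dag_arc:
  assumes "connected_graph G" "a \<in> arcs G"
  shows "dag G a \<in> arcs G" "dag G (dag G a) = a" "dag G a \<noteq> a"
  using assms by (auto simp: connected_graph_def is_graph_def)

lemma orientationD:
  assumes "x \<in> orientations G" "a \<in> arcs G"
  shows "x a = 1 \<or> x a = -1" "x (dag G a) = - x a"
  using assms PiE_mem[of x "arcs G" "\<lambda>_. {1, -1}" a] by (simp_all add: orientations_def)

text \<open>The restriction maps of the presheaf of orientations, whose category of elements is
  \<open>Uo_cat\<close>. The cut-off at the arcs keeps the result extensional, as
  \<open>orientations\<close> requires.\<close>

definition pull :: "gmap \<Rightarrow> (nat \<Rightarrow> int) \<Rightarrow> nat \<Rightarrow> int" where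
  "pull \<phi> x = (\<lambda>a\<in>arcs (gdom \<phi>). x (gmap0 \<phi> a))"

definition lift :: "gmap \<Rightarrow> (nat \<Rightarrow> int) \<Rightarrow> omap" where
  "lift \<phi> x = (pull \<phi> x, \<phi>, x)"

lemma pull_orientation:
  assumes \<phi>: "graphical_map \<phi>" and x: "x \<in> orientations (gcod \<phi>)"
  shows "pull \<phi> x \<in> orientations (gdom \<phi>)"
proof -
  have "connected_graph (gdom \<phi>)"
    using \<phi> by (simp add: graphical_map_ends)
  note d = dag_arc(1)[OF this] and g = gmap0_arc[OF \<phi>]
  show ?thesis
    using x d g unfolding orientations_def pull_def by auto
qed

lemma pull_gid:
  assumes "x \<in> orientations G"
  shows "pull (gid G) x = x"
proof
  show "pull (gid G) x a = x a" for a
    using assms by (auto simp: pull_def orientations_def PiE_def extensional_def)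
qed

lemma pull_gcomp:
  assumes "graphical_map \<phi>" "gcod \<phi> = gdom \<psi>"
  shows "pull (gcomp \<psi> \<phi>) x = pull \<phi> (pull \<psi> x)"
  using assms gmap0_arc(1)[of \<phi>] by (auto simp: pull_def gcomp_def compose_def)

text \<open>The discrete fibration property: the condition on a morphism fixes the source
  orientation on all arcs, and extensionality fixes it elsewhere, so a morphism amounts to a
  graphical map and an orientation of its target.\<close>

lemma in_Arr_Uo_iff:
  "p \<in> Arr Uo_cat \<longleftrightarrow>
     (\<exists>\<phi> x. p = lift \<phi> x \<and> graphical_map \<phi> \<and> x \<in> orientations (gcod \<phi>))"
proof
  assume "p \<in> Arr Uo_cat"
  then obtain x \<phi> x' where p: "p = (x, \<phi>, x')" and \<phi>: "graphical_map \<phi>"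
    and x: "x \<in> orientations (gdom \<phi>)" and x': "x' \<in> orientations (gcod \<phi>)"
    and xx': "\<forall>a\<in>arcs (gdom \<phi>). x' (gmap0 \<phi> a) = x a"
    by (auto simp: Uo_cat_def)
  have "x = pull \<phi> x'"
    using x xx' by (auto simp: pull_def orientations_def PiE_def extensional_def)
  then show "\<exists>\<phi> x. p = lift \<phi> x \<and> graphical_map \<phi> \<and> x \<in> orientations (gcod \<phi>)"
    using p \<phi> x' by (auto simp: lift_def)
next
  assume "\<exists>\<phi> x. p = lift \<phi> x \<and> graphical_map \<phi> \<and> x \<in> orientations (gcod \<phi>)"
  then obtain \<phi> x where "p = lift \<phi> x" "graphical_map \<phi>" "x \<in> orientations (gcod \<phi>)"
    by blast
  then show "p \<in> Arr Uo_cat"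
    using pull_orientation[of \<phi> x] by (auto simp: Uo_cat_def lift_def pull_def)
qed

lemma lift_in_Arr:
  assumes "graphical_map \<phi>" "x \<in> orientations (gcod \<phi>)"
  shows "lift \<phi> x \<in> Arr Uo_cat"
  using assms by (auto simp: in_Arr_Uo_iff)

lemma lift_simps [simp]:
  "Dom Uo_cat (lift \<phi> x) = (gdom \<phi>, pull \<phi> x)" "Cod Uo_cat (lift \<phi> x) = (gcod \<phi>, x)"
  "lift \<phi> x \<in> Inert Uo_cat \<longleftrightarrow> inert \<phi>" "FArr forget (lift \<phi> x) = \<phi>"
  by (simp_all add: lift_def)

lemma lift_eq_iff [simp]: "lift \<phi> x = lift \<psi> y \<longleftrightarrow> \<phi> = \<psi> \<and> x = y"
  by (auto simp: lift_def)

lemma Comp_lift: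
  assumes "graphical_map \<phi>" "gcod \<phi> = gdom \<psi>"
  shows "Comp Uo_cat (lift \<psi> x) (lift \<phi> (pull \<psi> x)) = lift (gcomp \<psi> \<phi>) x"
  using assms by (simp add: lift_def pull_gcomp)

lemma Uo_ends:
  assumes "f \<in> Arr Uo_cat"
  shows "Dom Uo_cat f \<in> Obj Uo_cat \<and> Cod Uo_cat f \<in> Obj Uo_cat"
  using assms pull_orientation by (auto simp: in_Arr_Uo_iff graphical_map_ends)

section \<open>Elementary objects and gluing over an oriented graph\<close>

lemma elts_over_U_iff:
  "p \<in> elts_over U_cat G \<longleftrightarrow>
     graphical_map p \<and> inert p \<and> elementary_graph (gdom p) \<and> gcod p = G"
  by (auto simp: elts_over_def graphical_map_ends)

text \<open>Being inert or elementary is tested on underlying graphs, and an object over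
  \<open>(G, x)\<close> has its target orientation prescribed.\<close>

lemma elts_over_Uo:
  assumes "x \<in> orientations G"
  shows "elts_over Uo_cat (G, x) = (\<lambda>p. lift p x) ` elts_over U_cat G"
proof (intro set_eqI iffI)
  fix P assume "P \<in> elts_over Uo_cat (G, x)"
  then show "P \<in> (\<lambda>p. lift p x) ` elts_over U_cat G"
    by (auto simp: elts_over_def in_Arr_Uo_iff)
next
  fix P assume "P \<in> (\<lambda>p. lift p x) ` elts_over U_cat G"
  then show "P \<in> elts_over Uo_cat (G, x)"
    using assms pull_orientation by (auto simp: elts_over_def lift_in_Arr)
qed

text \<open>A morphism over \<open>(G, x)\<close> into \<open>lift q x\<close> must have target
  orientation \<open>pull q x\<close>, so it is a lift of some \<open>h\<close>. Conversely, such a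
  lift of any \<open>h\<close> with \<open>gcomp q h = p\<close> starts at \<open>pull p x\<close>,
  by functoriality of \<open>pull\<close>. Compatibility thus ranges over the same maps as in
  \<open>U_cat\<close>.\<close>

lemma compatible_Uo_iff:
  assumes x: "x \<in> orientations G"
  shows "compatible Uo_cat Z (G, x) s \<longleftrightarrow>
     (\<forall>p\<in>elts_over U_cat G. s (lift p x) \<in> Val Z (gdom p, pull p x)) \<and>
     (\<forall>p\<in>elts_over U_cat G. \<forall>q\<in>elts_over U_cat G. \<forall>h.
        graphical_map h \<and> inert h \<and> gdom h = gdom p \<and> gcod h = gdom q \<and> gcomp q h = p \<longrightarrow>
        Res Z (lift h (pull q x)) (s (lift q x)) = s (lift p x))"
    (is "?L \<longleftrightarrow> ?A \<and> ?B")
proof -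
  have "(\<forall>H\<in>Arr Uo_cat. H \<in> Inert Uo_cat \<and> Dom Uo_cat H = Dom Uo_cat (lift p x) \<and>
            Cod Uo_cat H = Dom Uo_cat (lift q x) \<and> Comp Uo_cat (lift q x) H = lift p x \<longrightarrow> P H) \<longleftrightarrow>
        (\<forall>h. graphical_map h \<and> inert h \<and> gdom h = gdom p \<and> gcod h = gdom q \<and> gcomp q h = p \<longrightarrow>
            P (lift h (pull q x)))" (is "?l \<longleftrightarrow> ?r")
    if p: "p \<in> elts_over U_cat G" and q: "q \<in> elts_over U_cat G" for p q P
  proof
    assume l: ?l
    show ?r
    proof (intro allI impI)
      fix h assume h: "graphical_map h \<and> inert h \<and> gdom h = gdom p \<and> gcod h = gdom q \<and> gcomp q h = p"
      have "pull q x \<in> orientations (gdom q)"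
        using q x pull_orientation by (auto simp: elts_over_U_iff)
      then show "P (lift h (pull q x))"
        using h l Comp_lift[of h q x] pull_gcomp[of h q x] by (simp add: lift_in_Arr)
    qed
  next
    assume r: ?r
    show ?l
    proof (intro ballI impI)
      fix H assume "H \<in> Arr Uo_cat" and H: "H \<in> Inert Uo_cat \<and> Dom Uo_cat H = Dom Uo_cat (lift p x) \<and>
            Cod Uo_cat H = Dom Uo_cat (lift q x) \<and> Comp Uo_cat (lift q x) H = lift p x"
      then obtain h y where h: "H = lift h y" "graphical_map h"
        by (auto simp: in_Arr_Uo_iff)
      then have y: "y = pull q x" and "gcod h = gdom q"
        using H by auto
      then show "P H"
        using r h H Comp_lift[of h q x] by simp
    qed
  qed
  then show ?thesis
    unfolding compatible_def elts_over_Uo[OF x] ball_simps by simp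
qed

lemma glues_Uo_iff:
  assumes "x \<in> orientations G"
  shows "glues Uo_cat Z (G, x) s z \<longleftrightarrow>
     z \<in> Val Z (G, x) \<and> (\<forall>p\<in>elts_over U_cat G. Res Z (lift p x) z = s (lift p x))"
  by (auto simp: glues_def elts_over_Uo[OF assms])

lemma compatible_U_iff:
  "compatible U_cat Y G t \<longleftrightarrow>
     (\<forall>p\<in>elts_over U_cat G. t p \<in> Val Y (gdom p)) \<and>
     (\<forall>p\<in>elts_over U_cat G. \<forall>q\<in>elts_over U_cat G. \<forall>h.
        graphical_map h \<and> inert h \<and> gdom h = gdom p \<and> gcod h = gdom q \<and> gcomp q h = p \<longrightarrow>
        Res Y h (t q) = t p)"
  unfolding compatible_def by (simp add: imp_conjL)

section \<open>Restriction along the forgetful functor\<close>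

lemma restriction_forget_presheaf:
  assumes "is_presheaf U_cat Y"
  shows "is_presheaf Uo_cat (restriction forget Y)"
  using assms unfolding is_presheaf_def restriction_def
  by (fastforce simp: Uo_cat_def forget_def)

text \<open>Values and restriction maps of \<open>restriction forget Y\<close> ignore orientations,
  so reindexing along \<open>p \<mapsto> lift p x\<close> matches both the compatible families over
  \<open>(G, x)\<close> with those over \<open>G\<close> and their gluings.\<close>

lemma segal_restriction_forget:
  assumes Y: "segal U_cat Y"
  shows "segal Uo_cat (restriction forget Y)"
  unfolding segal_iff_glues
proof (intro conjI ballI allI impI)
  show "is_presheaf Uo_cat (restriction forget Y)"
    using Y by (simp add: restriction_forget_presheaf segal_def)
next
  fix c s
  assume "c \<in> Obj Uo_cat" and s: "compatible Uo_cat (restriction forget Y) c s"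
  then obtain G x where c: "c = (G, x)" and G: "connected_graph G" and x: "x \<in> orientations G"
    by (cases c) auto
  let ?t = "\<lambda>p. s (lift p x)"
  have "compatible U_cat Y G ?t"
    using s unfolding c compatible_Uo_iff[OF x] compatible_U_iff by (simp add: restriction_def)
  moreover have "glues Uo_cat (restriction forget Y) c s z \<longleftrightarrow> glues U_cat Y G ?t z" for z
    unfolding c glues_Uo_iff[OF x] by (simp add: glues_def restriction_def)
  ultimately show "\<exists>!z. glues Uo_cat (restriction forget Y) c s z"
    using Y G unfolding segal_iff_glues by simp
qed

section \<open>Edges and the Segal condition for orientations\<close>

text \<open>Arc \<open>0\<close> is the distinguished one. The maps for \<open>a\<close> and
  \<open>dag G a\<close> differ by the flip of the edge, so there is one map for each arc and not
  just for each class of edges.\<close>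

definition arc_emb :: "graph \<Rightarrow> nat \<Rightarrow> emap" where
  "arc_emb G a = \<lparr>edom = edge_graph, ecod = G,
     earc = (\<lambda>i\<in>{0, 1}. if i = 0 then a else dag G a), evert = (\<lambda>v\<in>{}. undefined)\<rparr>"

definition arc_map :: "graph \<Rightarrow> nat \<Rightarrow> gmap" where
  "arc_map G a = gmap_of (arc_emb G a)"

lemma edge_graph_simps [simp]:
  "arcs edge_graph = {0, 1}" "verts edge_graph = {}" "inn edge_graph = {}"
  "dag edge_graph 0 = 1" "dag edge_graph (Suc 0) = 0" "bdry edge_graph = {0, 1}"
  by (simp_all add: edge_graph_def bdry_def)

lemma is_graph_edge_graph: "is_graph edge_graph"
  by (auto simp: is_graph_def edge_graph_def)

text \<open>In the absence of vertices a non-empty piece must contain an arc, and being closed under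
  the involution it then contains both, which leaves nothing for the other piece.\<close>

lemma connected_edge_graph: "connected_graph edge_graph"
proof -
  have False
    if HK: "is_graph H" "is_graph K" "nonempty_graph H" "nonempty_graph K"
      and u: "is_disjoint_union edge_graph H K" for H K
  proof -
    have arcs: "arcs H \<union> arcs K = {0, 1}" "arcs H \<inter> arcs K = {}"
      and "verts H = {}" "verts K = {}"
      and dag: "\<forall>a\<in>arcs H. dag edge_graph a = dag H a" "\<forall>a\<in>arcs K. dag edge_graph a = dag K a"
      using u by (auto simp: is_disjoint_union_def)
    then have ne: "arcs H \<noteq> {}" "arcs K \<noteq> {}"
      using HK by (auto simp: nonempty_graph_def)
    have closed: "a \<in> arcs L \<Longrightarrow> dag L a \<in> arcs L" if "is_graph L" for L a
      using that by (auto simp: is_graph_def)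
    have "dag edge_graph a \<in> arcs H" if "a \<in> arcs H" for a
      using closed[OF HK(1) that] dag(1) that by metis
    from this[of 0] this[of 1] have iff: "0 \<in> arcs H \<longleftrightarrow> 1 \<in> arcs H"
      by (simp only: edge_graph_simps One_nat_def) blast
    show False
    proof (cases "0 \<in> arcs H")
      case True
      then have "{0, 1} \<subseteq> arcs H"
        using iff by simp
      then show False
        using arcs ne(2) by blast
    next
      case False
      then have "{0, 1} \<inter> arcs H = {}"
        using iff by simp
      then show False
        using arcs(1) ne(1) by blast
    qed
  qed
  then show ?thesis
    unfolding connected_graph_def
    using is_graph_edge_graph by (auto simp: nonempty_graph_def)
qed

lemma elementary_edge_graph: "elementary_graph edge_graph"
proof -
  have "graph_iso (emap_id edge_graph)"
    using is_graph_edge_graph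
    by (auto simp: graph_iso_def emap_id_def etale_def bij_betw_def inj_on_def)
  then have "isomorphic_graphs edge_graph edge_graph"
    unfolding isomorphic_graphs_def by (intro exI[of _ "emap_id edge_graph"]) (simp add: emap_id_def)
  then show ?thesis
    by (simp add: elementary_graph_def)
qed

lemma arc_map_simps [simp]:
  "gdom (arc_map G a) = edge_graph" "gcod (arc_map G a) = G"
  "gmap0 (arc_map G a) 0 = a" "gmap0 (arc_map G a) (Suc 0) = dag G a"
  by (simp_all add: arc_map_def gmap_of_def arc_emb_def)

text \<open>The conditions at vertices are vacuous, and so is condition (c), since the edge has a
  non-empty boundary. Only compatibility with the involutions remains.\<close>

lemma arc_map:
  assumes G: "connected_graph G" and a: "a \<in> arcs G"
  shows "graphical_map (arc_map G a)" "inert (arc_map G a)"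
proof -
  note d = dag_arc[OF G a]
  have "is_graph G"
    using G by (simp add: connected_graph_def)
  then have "embedding (arc_emb G a)"
    using is_graph_edge_graph connected_edge_graph G a d
    by (auto simp: embedding_def etale_def arc_emb_def)
  then show "inert (arc_map G a)"
    by (auto simp: inert_def arc_map_def)
  show "graphical_map (arc_map G a)"
    using connected_edge_graph G a d
    by (auto simp: graphical_map_def arc_map_def gmap_of_def arc_emb_def disjoint_family_on_def)
qed

lemma arc_map_elt:
  assumes "connected_graph G" "a \<in> arcs G"
  shows "arc_map G a \<in> elts_over U_cat G"
  using arc_map[OF assms] elementary_edge_graph by (simp add: elts_over_U_iff)

text \<open>Makes \<open>arc_map (gdom p) b\<close> a morphism over \<open>gcod p\<close> from the
  edge of the image arc to \<open>p\<close>. Through such morphisms compatibility compares the datum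
  at \<open>p\<close> with the data at edges.\<close>

lemma gcomp_arc_map:
  assumes p: "graphical_map p" and b: "b \<in> arcs (gdom p)"
  shows "gcomp p (arc_map (gdom p) b) = arc_map (gcod p) (gmap0 p b)"
proof -
  have "gmap0 (gcomp p (arc_map (gdom p) b)) i = gmap0 (arc_map (gcod p) (gmap0 p b)) i" for i
    using gmap0_arc(2)[OF p b]
    by (cases "i \<in> {0, 1}") (auto simp: gcomp_def compose_def arc_map_def gmap_of_def arc_emb_def)
  \<comment> \<open>The edge has no vertices, so both sides are restrictions to the empty set and
    the definite description in \<open>gcomp\<close> is never evaluated.\<close>
  moreover have "gmap1 (gcomp p (arc_map (gdom p) b)) = gmap1 (arc_map (gcod p) (gmap0 p b))"
    by (simp add: gcomp_def arc_map_def gmap_of_def arc_emb_def restrict_def)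
  ultimately show ?thesis
    by (intro gmap.equality ext) simp_all
qed

lemma pull_arc_map: "pull (arc_map G a) x 0 = x a"
  by (simp add: pull_def)

text \<open>Existence in the Segal condition for orientations. Edges alone define \<open>x\<close>;
  compatibility along the edges of each \<open>p\<close> then shows that \<open>x\<close> restricts
  to \<open>y p\<close>.\<close>

lemma orientation_glue:
  assumes G: "connected_graph G"
    and y: "\<And>p. p \<in> elts_over U_cat G \<Longrightarrow> y p \<in> orientations (gdom p)"
    and compat: "\<And>p q h. \<lbrakk>p \<in> elts_over U_cat G; q \<in> elts_over U_cat G; graphical_map h; inert h;
      gdom h = gdom p; gcod h = gdom q; gcomp q h = p\<rbrakk> \<Longrightarrow> pull h (y q) = y p"
  obtains x where "x \<in> orientations G" "\<And>p. p \<in> elts_over U_cat G \<Longrightarrow> pull p x = y p"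
proof -
  define x where "x = (\<lambda>a\<in>arcs G. y (arc_map G a) 0)"
  have xp: "x (gmap0 p b) = y p b" if p: "p \<in> elts_over U_cat G" and b: "b \<in> arcs (gdom p)" for p b
  proof -
    have gp: "graphical_map p" "gcod p = G" "connected_graph (gdom p)"
      using p by (auto simp: elts_over_U_iff graphical_map_ends)
    have pb: "gmap0 p b \<in> arcs G"
      using gmap0_arc(1)[OF gp(1) b] gp by simp
    \<comment> \<open>Compatibility for the arc \<open>b\<close>, viewed as a morphism from the edge
      of \<open>gmap0 p b\<close> to \<open>p\<close>. Evaluation at arc \<open>0\<close> gives the
      claim.\<close>
    have "pull (arc_map (gdom p) b) (y p) = y (arc_map G (gmap0 p b))"
      using arc_map[OF gp(3) b] gcomp_arc_map[OF gp(1) b] gp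
      by (intro compat[OF arc_map_elt[OF G pb] p]) auto
    then show ?thesis
      using pb by (metis pull_arc_map x_def restrict_apply')
  qed
  have "x \<in> orientations G"
  proof -
    have "x a \<in> {1, -1} \<and> x (dag G a) = - x a" if a: "a \<in> arcs G" for a
    proof -
      note e = arc_map_elt[OF G a]
      \<comment> \<open>By definition \<open>x (dag G a)\<close> comes from the edge
        \<open>arc_map G (dag G a)\<close>; by \<open>xp\<close> it is also the value at arc
        \<open>1\<close> of \<open>arc_map G a\<close>, where the sign rule for a single orientation
        of the edge applies.\<close>
      have "x a = y (arc_map G a) 0" "x (dag G a) = y (arc_map G a) (dag edge_graph 0)"
        using xp[OF e, of 0] xp[OF e, of 1] by simp_all
      then show ?thesis
        using orientationD[OF y[OF e], of 0] by simp
    qed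
    then show ?thesis
      unfolding orientations_def by (auto simp: x_def)
  qed
  moreover have "pull p x = y p" if p: "p \<in> elts_over U_cat G" for p
    using y[OF p] xp[OF p] by (auto simp: pull_def orientations_def PiE_def extensional_def)
  ultimately show ?thesis
    using that by blast
qed

text \<open>Uniqueness in the same Segal condition: pulling back to the edge of \<open>a\<close> and
  evaluating at arc \<open>0\<close> recovers the value at \<open>a\<close>.\<close>

lemma orientation_unique:
  assumes G: "connected_graph G" and x: "x \<in> orientations G" and y: "y \<in> orientations G"
    and eq: "\<And>p. p \<in> elts_over U_cat G \<Longrightarrow> pull p x = pull p y"
  shows "x = y"
proof (rule PiE_ext)
  show "x \<in> arcs G \<rightarrow>\<^sub>E {1, -1}" "y \<in> arcs G \<rightarrow>\<^sub>E {1, -1}"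
    using x y by (simp_all add: orientations_def)
  show "x a = y a" if "a \<in> arcs G" for a
    using eq[OF arc_map_elt[OF G that]] pull_arc_map by metis
qed

section \<open>The left Kan extension\<close>

lemma finite_orientations:
  assumes "connected_graph G"
  shows "finite (orientations G)"
proof (rule finite_subset)
  show "orientations G \<subseteq> arcs G \<rightarrow>\<^sub>E {1, -1}"
    by (auto simp: orientations_def)
  show "finite (arcs G \<rightarrow>\<^sub>E {1, -1 :: int})"
    using assms by (intro finite_PiE) (auto simp: connected_graph_def is_graph_def)
qed

text \<open>Cardinal arithmetic: the finite factor is smaller than the infinite one, and a product
  with an infinite set that bounds both factors is bounded by that set. This lets the coproduct take
  its values in the same type \<open>'x\<close> as \<open>Z\<close>.\<close>

lemma inj_finite_Times_infinite:
  includes cardinal_syntax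
  assumes "finite A" "infinite (UNIV :: 'x set)"
  shows "\<exists>e :: 'a \<times> 'x \<Rightarrow> 'x. inj_on e (A \<times> UNIV)"
proof -
  have "|A| \<le>o |UNIV :: 'x set|"
    using assms finite_ordLess_infinite[OF card_of_Well_order card_of_Well_order, of A]
    by (intro ordLess_imp_ordLeq) (simp add: Field_card_of)
  then have "|A \<times> (UNIV :: 'x set)| \<le>o |UNIV :: 'x set|"
    using card_of_Times_ordLeq_infinite_Field[OF _ _ card_of_mono1[OF subset_refl] card_of_Card_order]
      assms(2)
    by (simp add: Field_card_of)
  then show ?thesis
    unfolding card_of_ordLeq[symmetric] by blast
qed

text \<open>
  \<open>e G\<close> embeds the coproduct over the orientations of \<open>G\<close> into the type \<open>'x\<close>; it exists because
  there are only finitely many orientations and \<open>'x\<close> is infinite.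
\<close>

locale orientation_coding =
  fixes e :: "graph \<Rightarrow> (nat \<Rightarrow> int) \<times> 'x \<Rightarrow> 'x"
    and Z :: "(ograph, omap, 'x) presheaf"
  assumes inj_e: "connected_graph G \<Longrightarrow> inj_on (e G) (orientations G \<times> UNIV)"
    and presheaf_Z: "is_presheaf Uo_cat Z"
begin

text \<open>The coproduct formula for left Kan extension along a discrete fibration, with pairs
  coded by \<open>e\<close>. Decoding inverts \<open>e\<close> on all of
  \<open>orientations G \<times> UNIV\<close>, so it is correct for every second component and not
  only for elements of \<open>Z\<close>.\<close>

definition K :: "(graph, gmap, 'x) presheaf" where
  "K = \<lparr>Val = (\<lambda>G. {e G (x, z) | x z. x \<in> orientations G \<and> z \<in> Val Z (G, x)}),
     Res = (\<lambda>\<phi> w. let (x, z) = the_inv_into (orientations (gcod \<phi>) \<times> UNIV) (e (gcod \<phi>)) w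
                  in e (gdom \<phi>) (pull \<phi> x, Res Z (lift \<phi> x) z))\<rparr>"

text \<open>The inclusions of the summands, made extensional as \<open>nat_trans\<close>
  demands.\<close>

definition unit :: "ograph \<Rightarrow> 'x \<Rightarrow> 'x" where
  "unit = (\<lambda>c\<in>Obj Uo_cat. \<lambda>z\<in>Val Z c. e (fst c) (snd c, z))"

lemma e_eq_iff:
  assumes "connected_graph G" "x \<in> orientations G" "y \<in> orientations G"
  shows "e G (x, z) = e G (y, w) \<longleftrightarrow> x = y \<and> z = w"
  using inj_on_eq_iff[OF inj_e[OF assms(1)], of "(x, z)" "(y, w)"] assms by simp

lemma Val_KE:
  assumes "w \<in> Val K G"
  obtains x z where "w = e G (x, z)" "x \<in> orientations G" "z \<in> Val Z (G, x)"
  using assms by (auto simp: K_def)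

lemma Val_KI: "x \<in> orientations G \<Longrightarrow> z \<in> Val Z (G, x) \<Longrightarrow> e G (x, z) \<in> Val K G"
  by (auto simp: K_def)

lemma Res_K:
  assumes "connected_graph (gcod \<phi>)" "x \<in> orientations (gcod \<phi>)"
  shows "Res K \<phi> (e (gcod \<phi>) (x, z)) = e (gdom \<phi>) (pull \<phi> x, Res Z (lift \<phi> x) z)"
  using assms by (simp add: K_def the_inv_into_f_f inj_e)

lemma Res_Z_in:
  assumes "graphical_map \<phi>" "x \<in> orientations (gcod \<phi>)" "z \<in> Val Z (gcod \<phi>, x)"
  shows "Res Z (lift \<phi> x) z \<in> Val Z (gdom \<phi>, pull \<phi> x)"
  using presheaf_Res_in[OF presheaf_Z lift_in_Arr[OF assms(1,2)]] assms(3) by simp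

text \<open>Functoriality splits into that of \<open>pull\<close> on orientations and that of
  \<open>Z\<close> on elements, since lifts respect identities and composites.\<close>

lemma presheaf_K: "is_presheaf U_cat K"
  unfolding is_presheaf_def
proof (intro conjI ballI impI)
  fix f assume "f \<in> Arr U_cat"
  then have f: "graphical_map f" "connected_graph (gcod f)"
    by (auto simp: graphical_map_ends)
  show "Res K f \<in> Val K (Cod U_cat f) \<rightarrow> Val K (Dom U_cat f)"
  proof
    fix w assume "w \<in> Val K (Cod U_cat f)"
    then obtain x z where w: "w = e (gcod f) (x, z)" "x \<in> orientations (gcod f)"
      "z \<in> Val Z (gcod f, x)"
      by (auto elim: Val_KE)
    then show "Res K f w \<in> Val K (Dom U_cat f)"
      using f by (simp add: Res_K Val_KI pull_orientation Res_Z_in)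
  qed
next
  fix G w assume "G \<in> Obj U_cat" and "w \<in> Val K G"
  then obtain x z where G: "connected_graph G" and w: "w = e G (x, z)" and x: "x \<in> orientations G"
    and z: "z \<in> Val Z (G, x)"
    by (auto elim: Val_KE)
  have "lift (gid G) x = Id Uo_cat (G, x)"
    using x by (simp add: lift_def pull_gid)
  then have "Res Z (lift (gid G) x) z = z"
    using presheaf_Z G x z Uo_cat_simps(1)[of G x] unfolding is_presheaf_def by metis
  then show "Res K (Id U_cat G) w = w"
    using Res_K[of "gid G" x z] G x by (simp add: w pull_gid)
next
  fix f g w assume "f \<in> Arr U_cat" "g \<in> Arr U_cat" "Cod U_cat f = Dom U_cat g"
    "w \<in> Val K (Cod U_cat g)"
  then obtain x z where f: "graphical_map f" "connected_graph (gcod f)"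
    and g: "graphical_map g" "connected_graph (gcod g)"
    and fg: "gcod f = gdom g" and w: "w = e (gcod g) (x, z)" and x: "x \<in> orientations (gcod g)"
    and z: "z \<in> Val Z (gcod g, x)"
    by (auto simp: graphical_map_ends elim: Val_KE)
  have gx: "pull g x \<in> orientations (gcod f)"
    using g x fg pull_orientation by simp
  have "Res Z (lift (gcomp g f) x) z = Res Z (lift f (pull g x)) (Res Z (lift g x) z)"
    using presheaf_Res_Comp[OF presheaf_Z lift_in_Arr[OF f(1) gx] lift_in_Arr[OF g(1) x], of z] z fg
    by (simp add: Comp_lift[OF f(1) fg])
  then show "Res K (Comp U_cat g f) w = Res K f (Res K g w)"
    using Res_K[of "gcomp g f" x z] Res_K[OF g(2) x] Res_K[OF f(2) gx] g f fg x
    by (simp add: w pull_gcomp)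
qed

lemma unit_simp [simp]:
  assumes "connected_graph G" "x \<in> orientations G" "z \<in> Val Z (G, x)"
  shows "unit (G, x) z = e G (x, z)"
  using assms by (simp add: unit_def)

lemma nat_trans_unit: "nat_trans Uo_cat Z (restriction forget K) unit"
  unfolding unit_def
proof (rule nat_trans_restrict[OF presheaf_Z Uo_ends])
  fix c z assume "c \<in> Obj Uo_cat" "z \<in> Val Z c"
  then show "e (fst c) (snd c, z) \<in> Val (restriction forget K) c"
    by (cases c) (simp add: restriction_def Val_KI)
next
  fix f z assume f: "f \<in> Arr Uo_cat" and "z \<in> Val Z (Cod Uo_cat f)"
  then obtain \<phi> x where "f = lift \<phi> x" "connected_graph (gcod \<phi>)" "x \<in> orientations (gcod \<phi>)"
    by (auto simp: in_Arr_Uo_iff graphical_map_ends)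
  then show "e (fst (Dom Uo_cat f)) (snd (Dom Uo_cat f), Res Z f z) =
      Res (restriction forget K) f (e (fst (Cod Uo_cat f)) (snd (Cod Uo_cat f), z))"
    by (simp add: restriction_def Res_K)
qed

text \<open>A map out of a coproduct is given by its components. The condition on
  \<open>unit\<close> prescribes the component at \<open>x\<close> to be
  \<open>\<alpha> (G, x)\<close>, and the summands exhaust \<open>Val K G\<close>, which gives
  existence and uniqueness.\<close>

lemma left_kan_K: "left_kan Uo_cat U_cat forget Z K unit"
  unfolding left_kan_def
proof (intro conjI allI impI)
  show "is_presheaf U_cat K" by (rule presheaf_K)
  show "nat_trans Uo_cat Z (restriction forget K) unit" by (rule nat_trans_unit)
next
  fix Y :: "(graph, gmap, 'x) presheaf" and \<alpha>
  assume "is_presheaf U_cat Y \<and> nat_trans Uo_cat Z (restriction forget Y) \<alpha>"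
  then have \<alpha>: "nat_trans Uo_cat Z (restriction forget Y) \<alpha>" by blast
  let ?b = "\<lambda>G w. let (x, z) = the_inv_into (orientations G \<times> UNIV) (e G) w in \<alpha> (G, x) z"
  let ?\<beta> = "\<lambda>G\<in>Obj U_cat. \<lambda>w\<in>Val K G. ?b G w"
  have b: "?b G (e G (x, z)) = \<alpha> (G, x) z" if "connected_graph G" "x \<in> orientations G" for G x z
    using that by (simp add: the_inv_into_f_f inj_e)
  have \<beta>: "?\<beta> G (e G (x, z)) = \<alpha> (G, x) z"
    if "connected_graph G" "x \<in> orientations G" "z \<in> Val Z (G, x)" for G x z
    using that b Val_KI by simp
  show "\<exists>!\<beta>. nat_trans U_cat K Y \<beta> \<and>
      (\<forall>c\<in>Obj Uo_cat. \<forall>z\<in>Val Z c. \<beta> (FObj forget c) (unit c z) = \<alpha> c z)"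
  proof (rule ex1I)
    have "nat_trans U_cat K Y ?\<beta>"
    proof (rule nat_trans_restrict[OF presheaf_K U_ends])
      fix G w assume "G \<in> Obj U_cat" "w \<in> Val K G"
      then obtain x z where "connected_graph G" "w = e G (x, z)" "x \<in> orientations G"
        "z \<in> Val Z (G, x)"
        by (auto elim: Val_KE)
      then show "?b G w \<in> Val Y G"
        using nat_trans_in[OF \<alpha>, of "(G, x)" z] by (simp add: b restriction_def del: split_paired_All)
    next
      fix f w assume "f \<in> Arr U_cat" "w \<in> Val K (Cod U_cat f)"
      then obtain x z where f: "graphical_map f" "connected_graph (gdom f)" "connected_graph (gcod f)"
        and w: "w = e (gcod f) (x, z)" and x: "x \<in> orientations (gcod f)"
        and z: "z \<in> Val Z (gcod f, x)"
        by (auto simp: graphical_map_ends elim: Val_KE)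
      \<comment> \<open>On the summand at \<open>x\<close>, naturality along \<open>f\<close> is
        naturality of \<open>\<alpha>\<close> along the lift of \<open>f\<close> at
        \<open>x\<close>.\<close>
      have "\<alpha> (gdom f, pull f x) (Res Z (lift f x) z) = Res Y f (\<alpha> (gcod f, x) z)"
        using nat_trans_natural[OF \<alpha> lift_in_Arr[OF f(1) x], of z] z by (simp add: restriction_def)
      then show "?b (Dom U_cat f) (Res K f w) = Res Y f (?b (Cod U_cat f) w)"
        using f x b[OF f(2) pull_orientation[OF f(1) x]] b[OF f(3) x] by (simp add: w Res_K)
    qed
    then show "nat_trans U_cat K Y ?\<beta> \<and>
        (\<forall>c\<in>Obj Uo_cat. \<forall>z\<in>Val Z c. ?\<beta> (FObj forget c) (unit c z) = \<alpha> c z)"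
    proof (intro conjI ballI)
      fix c z assume "c \<in> Obj Uo_cat" "z \<in> Val Z c"
      then obtain G x where c: "c = (G, x)"
        and G: "connected_graph G" "x \<in> orientations G" "z \<in> Val Z (G, x)"
        by (cases c) simp
      show "?\<beta> (FObj forget c) (unit c z) = \<alpha> c z"
        unfolding c forget_simps unit_simp[OF G] by (rule \<beta>[OF G])
    qed
    fix \<gamma>
    assume \<gamma>: "nat_trans U_cat K Y \<gamma> \<and>
        (\<forall>c\<in>Obj Uo_cat. \<forall>z\<in>Val Z c. \<gamma> (FObj forget c) (unit c z) = \<alpha> c z)"
    show "\<gamma> = ?\<beta>"
    proof (rule nat_trans_eqI)
      show "nat_trans U_cat K Y \<gamma>" "nat_trans U_cat K Y ?\<beta>"
        using \<gamma> \<open>nat_trans U_cat K Y ?\<beta>\<close> by blast+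
      fix G w assume "G \<in> Obj U_cat" "w \<in> Val K G"
      then obtain x z where G: "connected_graph G" and w: "w = e G (x, z)"
        and x: "x \<in> orientations G" and z: "z \<in> Val Z (G, x)"
        by (auto elim: Val_KE)
      have "\<gamma> (FObj forget (G, x)) (unit (G, x) z) = \<alpha> (G, x) z"
        using \<gamma> G x z Uo_cat_simps(1) by blast
      then show "\<gamma> G w = ?\<beta> G w"
        using \<beta>[OF G x z] G x z w by simp
    qed
  qed
qed

lemma segal_K:
  assumes segal: "segal Uo_cat Z"
  shows "segal U_cat K"
  unfolding segal_iff_glues
proof (intro conjI ballI allI impI)
  show "is_presheaf U_cat K" by (rule presheaf_K)
next
  fix G t
  assume "G \<in> Obj U_cat" and t: "compatible U_cat K G t"
  then have G: "connected_graph G" by simp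
  have "\<exists>y u. t p = e (gdom p) (y, u) \<and> y \<in> orientations (gdom p) \<and> u \<in> Val Z (gdom p, y)"
    if "p \<in> elts_over U_cat G" for p
    using that t unfolding compatible_U_iff by (blast elim: Val_KE)
  then obtain y u where yu: "\<And>p. p \<in> elts_over U_cat G \<Longrightarrow> t p = e (gdom p) (y p, u p)"
    and y: "\<And>p. p \<in> elts_over U_cat G \<Longrightarrow> y p \<in> orientations (gdom p)"
    and u: "\<And>p. p \<in> elts_over U_cat G \<Longrightarrow> u p \<in> Val Z (gdom p, y p)"
    by metis
  have gp: "graphical_map p" "gcod p = G" "connected_graph (gdom p)"
    if "p \<in> elts_over U_cat G" for p
    using that by (auto simp: elts_over_U_iff graphical_map_ends)
  \<comment> \<open>Both sides of \<open>Res K h (t q) = t p\<close> are codes at the same graph, so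
    injectivity of \<open>e\<close> separates the equation into one between orientations and one
    between elements.\<close>
  have compat: "pull h (y q) = y p \<and> Res Z (lift h (y q)) (u q) = u p"
    if "p \<in> elts_over U_cat G" "q \<in> elts_over U_cat G" and h: "graphical_map h" "inert h"
      "gdom h = gdom p" "gcod h = gdom q" "gcomp q h = p" for p q h
  proof -
    have "Res K h (t q) = t p"
      using t that unfolding compatible_U_iff by blast
    moreover have "Res K h (t q) = e (gdom p) (pull h (y q), Res Z (lift h (y q)) (u q))"
      using that yu y gp Res_K[of h "y q" "u q"] by simp
    moreover have "pull h (y q) \<in> orientations (gdom p)"
      using that y pull_orientation[of h "y q"] by simp
    ultimately show ?thesis
      using that yu y gp e_eq_iff by simp
  qed
  obtain x where x: "x \<in> orientations G" and px: "\<And>p. p \<in> elts_over U_cat G \<Longrightarrow> pull p x = y p"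
    using orientation_glue[OF G y] compat by metis
  \<comment> \<open>Families over \<open>(G, x)\<close> are indexed by triples; the middle entry is
    the underlying graphical map, at which \<open>u\<close> is read.\<close>
  let ?s = "\<lambda>P. u (fst (snd P))"
  have s: "?s (lift p x) = u p" for p x
    by (simp add: lift_def)
  have "compatible Uo_cat Z (G, x) ?s"
    unfolding compatible_Uo_iff[OF x] s using px u compat by simp
  then have "\<exists>!z. glues Uo_cat Z (G, x) ?s z"
    using segal G x unfolding segal_iff_glues by (simp del: split_paired_All)
  then obtain z where z: "glues Uo_cat Z (G, x) ?s z"
    and z_unique: "\<And>z'. glues Uo_cat Z (G, x) ?s z' \<Longrightarrow> z' = z"
    by blast
  \<comment> \<open>Comparing codes at every \<open>p\<close> shows that the orientation component
    of a gluing has the same pullbacks as \<open>x\<close>, hence equals \<open>x\<close> by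
    \<open>orientation_unique\<close>. What remains is a gluing of \<open>u\<close> in
    \<open>Z\<close>.\<close>
  have glues_K: "glues U_cat K G t (e G (x', z')) \<longleftrightarrow> x' = x \<and> glues Uo_cat Z (G, x) ?s z'"
    if x': "x' \<in> orientations G" "z' \<in> Val Z (G, x')" for x' z'
  proof -
    have "Res K p (e G (x', z')) = t p \<longleftrightarrow> pull p x' = pull p x \<and> Res Z (lift p x') z' = u p"
      if p: "p \<in> elts_over U_cat G" for p
    proof -
      have "Res K p (e G (x', z')) = e (gdom p) (pull p x', Res Z (lift p x') z')"
        using gp[OF p] G x' Res_K[of p x' z'] by simp
      moreover have "pull p x' \<in> orientations (gdom p)"
        using gp[OF p] x' pull_orientation by simp
      ultimately show ?thesis
        using gp[OF p] y[OF p] yu[OF p] px[OF p] e_eq_iff by simp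
    qed
    then show ?thesis
      using orientation_unique[OF G x'(1) x] x' Val_KI[OF x']
      unfolding glues_Uo_iff[OF x] s by (auto simp: glues_def)
  qed
  show "\<exists>!w. glues U_cat K G t w"
  proof (rule ex1I)
    show "glues U_cat K G t (e G (x, z))"
      using z glues_K[OF x] by (simp add: glues_def)
    fix w assume w: "glues U_cat K G t w"
    then obtain x' z' where "w = e G (x', z')" "x' \<in> orientations G" "z' \<in> Val Z (G, x')"
      by (auto simp: glues_def elim: Val_KE)
    then show "w = e G (x, z)"
      using w glues_K z_unique by blast
  qed
qed

end

section \<open>Existence of a Segal Kan extension and the two preservation statements\<close>

lemma left_kan_forget:
  fixes Z :: "(ograph, omap, 'x) presheaf"
  assumes inf: "infinite (UNIV :: 'x set)" and Z: "segal Uo_cat Z"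
  obtains K :: "(graph, gmap, 'x) presheaf" and \<eta>
  where "left_kan Uo_cat U_cat forget Z K \<eta>" "segal U_cat K"
proof -
  \<comment> \<open>The implication sits inside the existential so that one coding can be chosen for
    all \<open>G\<close> at once, arbitrary where \<open>G\<close> is not connected.\<close>
  have "\<exists>i :: (nat \<Rightarrow> int) \<times> 'x \<Rightarrow> 'x. connected_graph G \<longrightarrow> inj_on i (orientations G \<times> UNIV)" for G
    using inj_finite_Times_infinite[OF finite_orientations inf] by blast
  then obtain e :: "graph \<Rightarrow> (nat \<Rightarrow> int) \<times> 'x \<Rightarrow> 'x"
    where e: "\<And>G. connected_graph G \<Longrightarrow> inj_on (e G) (orientations G \<times> UNIV)"
    by metis
  interpret orientation_coding e Z
    using e Z by unfold_locales (auto simp: segal_def)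
  show ?thesis
    using that left_kan_K segal_K[OF Z] by blast
qed

text \<open>Since \<open>f_!\<close> is specified by its universal property, the first half asserts
  both that a left Kan extension exists within \<open>'x\<close> and that every one is Segal. The
  latter follows by comparison with the coproduct model.\<close>

theorem theorem2:
  assumes "infinite (UNIV :: 'x set)"
  shows "(\<forall>Z :: (ograph, omap, 'x) presheaf. segal Uo_cat Z \<longrightarrow>
            (\<exists>W \<eta>. left_kan Uo_cat U_cat forget Z W \<eta>) \<and>
            (\<forall>W \<eta>. left_kan Uo_cat U_cat forget Z W \<eta> \<longrightarrow> segal U_cat W)) \<and>
         (\<forall>Y :: (graph, gmap, 'x) presheaf. segal U_cat Y \<longrightarrow>
            segal Uo_cat (restriction forget Y))"
proof (intro conjI allI impI)
  fix Z :: "(ograph, omap, 'x) presheaf"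
  assume "segal Uo_cat Z"
  then obtain K :: "(graph, gmap, 'x) presheaf" and \<theta>
    where K: "left_kan Uo_cat U_cat forget Z K \<theta>" "segal U_cat K"
    using left_kan_forget[OF assms] by blast
  show "\<exists>W \<eta>. left_kan Uo_cat U_cat forget Z W \<eta>"
    using K(1) by blast
  fix W \<eta> assume W: "left_kan Uo_cat U_cat forget Z W \<eta>"
  obtain \<beta> \<gamma> where "nat_trans U_cat W K \<beta>" "nat_trans U_cat K W \<gamma>"
    "\<And>d w. d \<in> Obj U_cat \<Longrightarrow> w \<in> Val W d \<Longrightarrow> \<gamma> d (\<beta> d w) = w"
    "\<And>d v. d \<in> Obj U_cat \<Longrightarrow> v \<in> Val K d \<Longrightarrow> \<beta> d (\<gamma> d v) = v"
    using left_kan_unique_up_to_iso[OF W K(1) U_ends FObj_forget_in] by blast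
  moreover have "is_presheaf U_cat W"
    using W by (simp add: left_kan_def)
  ultimately show "segal U_cat W"
    using segal_iso_transfer[OF K(2) _ U_ends] by blast
qed (rule segal_restriction_forget)

end
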